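(* Let $n\ge 3$ and let $\varrho=(\rho_1,\dots,\rho_n)\in\mathcal{D}(\mathbb{C}^2)^n$ be any $n$-tuple of single-qubit density matrices with Bloch vectors $\mathbf{r}_1,\dots,\mathbf{r}_n$ and Gram matrix $G_{\mathbf{r}_\varrho}=(\langle\mathbf{r}_k,\mathbf{r}_l\rangle)_{k,l=1}^n$. Let $\lambda_1(G_{\mathbf{r}_\varrho})\ge\lambda_2(G_{\mathbf{r}_\varrho})\ge\lambda_3(G_{\mathbf{r}_\varrho})\ge\lambda_4(G_{\mathbf{r}_\varrho})=\cdots=\lambda_n(G_{\mathbf{r}_\varrho})=0$ denote the eigenvalues of $G_{\mathbf{r}_\varrho}$ in decreasing order. Then $$\frac{\lambda_3(G_{\mathbf{r}_\varrho})}{n}\le \mathsf{Im}_{R_1}(\varrho)\le\sqrt{\frac{\lambda_3(G_{\mathbf{r}_\varrho})}{n}}\le\frac{1}{\sqrt{3}}.$$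
   Context: $\mathcal{D}(\mathbb{C}^2)$ is the set of $2\times2$ density matrices. The Bloch vector of $\rho\in\mathcal{D}(\mathbb{C}^2)$ is the unique $\mathbf{r}\in\mathbb{R}^3$, $\|\mathbf{r}\|\le 1$, with $\rho=\frac{1}{2}(\mathbb{1}+\mathbf{r}\cdot\boldsymbol{\sigma})$, where $\boldsymbol{\sigma}=(\sigma_x,\sigma_y,\sigma_z)$ are the Pauli matrices. The robustness of imaginarity of a single state relative to the standard basis $\{|0\rangle,|1\rangle\}$ is $$\mathsf{Im}_R(\rho):=\min_{\tau\in\mathcal{D}(\mathbb{C}^2)}\Big\{s\ge 0 \,\Big|\, \tfrac{\rho+s\tau}{s+1}\text{ has only real entries in the standard basis}\Big\}.$$ For an $n$-tuple $\varrho=(\rho_1,\dots,\rho_n)\in\mathcal{D}(\mathbb{C}^2)^n$, $$\mathsf{Im}_{R_1}(\varrho):=\min_{U\in\mathrm{U}(2)}\frac{1}{n}\sum_{j=1}^n\mathsf{Im}_R(U\rho_jU^\dagger).$$ The eigenvalues $\lambda_i$ are counted with multiplicity (at most three are nonzero since the Bloch vectors lie in $\mathbb{R}^3$). *)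

theory Defs
  imports
    "HOL-Analysis.Analysis"
    "Jordan_Normal_Form.Char_Poly"
    "HOL-Computational_Algebra.Polynomial"
begin

text \<open>
  Qubit operators and Bloch vectors use the type-indexed vectors of \<^theory>\<open>HOL-Analysis.Analysis\<close>;
  only the Gram matrix, whose size \<open>n\<close> is a number, is a matrix of
  \<^theory>\<open>Jordan_Normal_Form.Matrix\<close>. Index \<open>1\<close> of \<^typ>\<open>complex ^ 2\<close> is the basis vector
  $|0\rangle$, index \<open>2\<close> is $|1\rangle$.
\<close>

no_notation Matrix.vec_index (infixl \<open>$\<close> 100)
no_notation Matrix.scalar_prod (infix \<open>\<bullet>\<close> 70)

definition dagger :: "complex ^ 2 ^ 2 \<Rightarrow> complex ^ 2 ^ 2" where
  "dagger A = (\<chi> i j. cnj (A $ j $ i))"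

definition unitary :: "complex ^ 2 ^ 2 \<Rightarrow> bool" where
  "unitary U \<longleftrightarrow> dagger U ** U = Finite_Cartesian_Product.mat 1 \<and>
                 U ** dagger U = Finite_Cartesian_Product.mat 1"

definition hermitian :: "complex ^ 2 ^ 2 \<Rightarrow> bool" where
  "hermitian A \<longleftrightarrow> dagger A = A"

definition psd :: "complex ^ 2 ^ 2 \<Rightarrow> bool" where
  "psd A \<longleftrightarrow> hermitian A \<and> (\<forall>v :: complex ^ 2. 0 \<le> Re (\<Sum>i\<in>UNIV. cnj (v $ i) * (A *v v) $ i))"

definition density_matrix :: "complex ^ 2 ^ 2 \<Rightarrow> bool" where
  "density_matrix A \<longleftrightarrow> psd A \<and> Determinants.trace A = 1"

definition sigma_x :: "complex ^ 2 ^ 2" where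
  "sigma_x = vector [vector [0, 1], vector [1, 0]]"

definition sigma_y :: "complex ^ 2 ^ 2" where
  "sigma_y = vector [vector [0, - \<i>], vector [\<i>, 0]]"

definition sigma_z :: "complex ^ 2 ^ 2" where
  "sigma_z = vector [vector [1, 0], vector [0, - 1]]"

definition bloch_vector :: "complex ^ 2 ^ 2 \<Rightarrow> real ^ 3" where
  "bloch_vector A = (THE r. norm r \<le> 1 \<and>
     A = (1 / 2) *\<^sub>R (Finite_Cartesian_Product.mat 1 +
           (r $ 1 *\<^sub>R sigma_x + r $ 2 *\<^sub>R sigma_y + r $ 3 *\<^sub>R sigma_z)))"

definition real_entries :: "complex ^ 2 ^ 2 \<Rightarrow> bool" where
  "real_entries A \<longleftrightarrow> (\<forall>i j. A $ i $ j \<in> \<real>)"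

text \<open>
  The minima are rendered by \<^const>\<open>Least\<close>, not by \<^const>\<open>Inf\<close>: the value is meaningful only
  if the minimum is attained.
\<close>

definition Im_R :: "complex ^ 2 ^ 2 \<Rightarrow> real" where
  "Im_R A = (LEAST s. 0 \<le> s \<and>
     (\<exists>T. density_matrix T \<and> real_entries ((1 / (s + 1)) *\<^sub>R (A + s *\<^sub>R T))))"

definition Im_R1 :: "nat \<Rightarrow> (nat \<Rightarrow> complex ^ 2 ^ 2) \<Rightarrow> real" where
  "Im_R1 n \<rho> = (LEAST v. \<exists>U. unitary U \<and>
     v = (1 / real n) * (\<Sum>j<n. Im_R (U ** \<rho> j ** dagger U)))"

definition gram_matrix :: "nat \<Rightarrow> (nat \<Rightarrow> real ^ 3) \<Rightarrow> real Matrix.mat" where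
  "gram_matrix n r = Matrix.mat n n (\<lambda>(k, l). inner (r k) (r l))"

text \<open>
  The real eigenvalues with algebraic multiplicity, in decreasing order. Positions are counted
  from \<open>0\<close>, so $\lambda_k$ is the entry at position \<open>k - 1\<close>.
\<close>

definition eigenvalues_desc :: "real Matrix.mat \<Rightarrow> real list" where
  "eigenvalues_desc A = rev (sorted_list_of_multiset (proots (char_poly A)))"

end

theory Submission
  imports Defs
begin

text \<open>
  For Hermitian \<open>A\<close> one has \<open>Im_R A = 2 \<bar>Im A\<^sub>1\<^sub>2\<bar>\<close>, the modulus of the y-component of the Bloch
  vector. Conjugation by unitaries rotates Bloch vectors, and every unit vector \<open>m\<close> can be rotated
  to the y-axis, so \<open>Im_R1\<close> is the minimum over the unit sphere of the mean of \<open>\<bar>m \<bullet> r\<^sub>j\<bar>\<close>.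
  The least value of \<open>\<Sum>\<^sub>j (m \<bullet> r\<^sub>j)\<^sup>2\<close> on the sphere is the third eigenvalue of the Gram matrix.
  The lower bound follows from \<open>\<bar>m \<bullet> r\<^sub>j\<bar> \<le> 1\<close>, the upper one from Cauchy--Schwarz at the minimiser,
  and the last one because the three leading eigenvalues sum to \<open>\<Sum>\<^sub>j \<bar>r\<^sub>j\<bar>\<^sup>2 \<le> n\<close>.
\<close>

section \<open>Characteristic polynomials of products and the spectrum of
  \<open>transpose_mat W * W\<close>\<close>

text \<open>The block matrix \<open>?M\<close> is eliminated in two ways. Its Schur complement at
  the identity block gives \<open>Determinant.det (?X - A * B)\<close>. Multiplying by
  \<open>?N\<close> from the left clears the lower left block and leaves \<open>?X - B * A\<close>,
  at the cost of a factor \<open>x ^ n\<close> on both sides; that factor cancels because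
  \<open>x\<close> is nonzero.\<close>

lemma det_scalar_minus_mult_commute:
  fixes A B :: "'a::idom Matrix.mat"
  assumes A: "A \<in> carrier_mat n n" and B: "B \<in> carrier_mat n n" and x: "x \<noteq> 0"
  shows "Determinant.det (x \<cdot>\<^sub>m 1\<^sub>m n - A * B) = Determinant.det (x \<cdot>\<^sub>m 1\<^sub>m n - B * A)"
proof -
  let ?X = "x \<cdot>\<^sub>m 1\<^sub>m n :: 'a Matrix.mat"
  let ?M = "four_block_mat ?X A B (1\<^sub>m n)"
  let ?N = "four_block_mat (1\<^sub>m n) (0\<^sub>m n n) (- B) ?X"
  have X: "?X \<in> carrier_mat n n" by simp
  have N: "?N \<in> carrier_mat (n + n) (n + n)" by auto
  have M: "?M \<in> carrier_mat (n + n) (n + n)" by auto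
  have detX: "Determinant.det ?X = x ^ n" by simp
  have "Determinant.det ?N = x ^ n"
    using B detX by (subst det_four_block_mat_upper_right_zero[of _ n _ n]) auto
  moreover have "?N * ?M = four_block_mat ?X A (0\<^sub>m n n) (?X - B * A)"
  proof -
    have "?X * B = x \<cdot>\<^sub>m B" "(- B) * ?X = - (x \<cdot>\<^sub>m B)"
      using B by (auto intro!: eq_matI)
    moreover have "- (x \<cdot>\<^sub>m B) + x \<cdot>\<^sub>m B = 0\<^sub>m n n" "- B * A + ?X = ?X - B * A"
      using A B by (auto intro!: eq_matI)
    ultimately show ?thesis
      using A B by (subst mult_four_block_mat[OF one_carrier_mat zero_carrier_mat _ X X A B]) auto
  qed
  moreover have "Determinant.det (four_block_mat ?X A (0\<^sub>m n n) (?X - B * A)) =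
      x ^ n * Determinant.det (?X - B * A)"
    using A B detX by (subst det_four_block_mat_lower_left_zero[of _ n _ n]) auto
  ultimately have "x ^ n * Determinant.det ?M = x ^ n * Determinant.det (?X - B * A)"
    using det_mult[OF N M] by metis
  moreover have "Determinant.det ?M = Determinant.det (?X - A * B)"
    using A B by (subst det_four_block_mat[of _ n]) auto
  ultimately show ?thesis using x by simp
qed

text \<open>Here \<open>x\<close> is the indeterminate \<open>[:0, 1:]\<close> of the polynomial
  ring, which is nonzero, so the cancellation is legitimate even when 0 is an eigenvalue.\<close>

lemma char_poly_mult_commute:
  fixes A B :: "'a::idom Matrix.mat"
  assumes A: "A \<in> carrier_mat n n" and B: "B \<in> carrier_mat n n"
  shows "char_poly (A * B) = char_poly (B * A)"
proof -
  let ?h = "map_mat (\<lambda>a. [:a:]) :: 'a Matrix.mat \<Rightarrow> 'a poly Matrix.mat"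
  have cp: "char_poly (C * D) = Determinant.det ([:0, 1:] \<cdot>\<^sub>m 1\<^sub>m n - ?h C * ?h D)"
    if "C \<in> carrier_mat n n" "D \<in> carrier_mat n n" for C D :: "'a Matrix.mat"
  proof -
    have "char_poly_matrix (C * D) = [:0, 1:] \<cdot>\<^sub>m 1\<^sub>m n - ?h (C * D)"
      using that unfolding char_poly_matrix_def by (intro eq_matI) auto
    then show ?thesis
      unfolding char_poly_def by (simp add: map_poly_mult(1)[OF that])
  qed
  show ?thesis
    unfolding cp[OF A B] cp[OF B A]
    by (rule det_scalar_minus_mult_commute) (use A B in auto)
qed

lemma proots_prod_linear_factors:
  "proots (\<Prod>a\<leftarrow>xs. [:- a, 1:]) = mset xs" for xs :: "'a::idom list"
  by (induction xs) (auto simp: proots_mult prod_list_zero_iff image_iff simp del: mult_pCons_left)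

text \<open>The roots of the common characteristic polynomial are read off the diagonal product
  \<open>W * transpose_mat W\<close>. This fixes the multiset of eigenvalues; the hypothesis on the
  order then fixes the list.\<close>

lemma eigenvalues_desc_transpose_mult:
  assumes W: "W \<in> carrier_mat n n"
    and diag: "\<And>i j. i < n \<Longrightarrow> j < n \<Longrightarrow> i \<noteq> j \<Longrightarrow> (W * transpose_mat W) $$ (i, j) = 0"
    and sorted: "sorted_wrt (\<ge>) (diag_mat (W * transpose_mat W))"
  shows "eigenvalues_desc (transpose_mat W * W) = diag_mat (W * transpose_mat W)"
proof -
  let ?D = "W * transpose_mat W"
  have D: "?D \<in> carrier_mat n n" using W by auto
  have "char_poly (transpose_mat W * W) = char_poly ?D"
    using W by (intro char_poly_mult_commute) auto
  also have "\<dots> = (\<Prod>a\<leftarrow>diag_mat ?D. [:- a, 1:])"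
    using D diag by (intro char_poly_upper_triangular) (auto simp: upper_triangular_def)
  finally have "proots (char_poly (transpose_mat W * W)) = mset (diag_mat ?D)"
    by (simp only: proots_prod_linear_factors)
  moreover have "sort (diag_mat ?D) = rev (diag_mat ?D)"
    using sorted by (intro properties_for_sort) (auto simp: sorted_wrt_rev)
  ultimately show ?thesis
    unfolding eigenvalues_desc_def by simp
qed

section \<open>Principal axes of the quadratic form of the vectors \<open>r j\<close>\<close>

text \<open>For \<open>V\<close> with columns \<open>r j\<close> this is the bilinear form of
  \<open>V\<close> times its transpose, whereas the Gram matrix is the transpose of \<open>V\<close>
  times \<open>V\<close>; the two share their nonzero eigenvalues.\<close>

definition correlation :: "nat \<Rightarrow> (nat \<Rightarrow> 'a::real_inner) \<Rightarrow> 'a \<Rightarrow> 'a \<Rightarrow> real" where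
  "correlation n r x y = (\<Sum>j<n. inner x (r j) * inner y (r j))"

lemma correlation_commute: "correlation n r x y = correlation n r y x"
  by (simp add: correlation_def mult.commute)

text \<open>On the unit circle spanned by \<open>e\<close> and \<open>f\<close> the quadratic form
  has its minimum at \<open>e\<close>, so its derivative in the direction \<open>f\<close>, which is
  twice the mixed term, vanishes. The argument is carried out algebraically.\<close>

lemma correlation_minimizer_orthogonal:
  fixes e f :: "'a::real_inner"
  assumes e: "norm e = 1" and f: "norm f = 1" and ef: "inner e f = 0"
    and min: "\<And>s t. norm (s *\<^sub>R e + t *\<^sub>R f) = 1 \<Longrightarrow>
      correlation n r e e \<le> correlation n r (s *\<^sub>R e + t *\<^sub>R f) (s *\<^sub>R e + t *\<^sub>R f)"
  shows "correlation n r e f = 0"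
proof -
  define a b c where "a = correlation n r e e" "b = correlation n r e f" "c = correlation n r f f"
  have expand: "correlation n r (s *\<^sub>R e + t *\<^sub>R f) (s *\<^sub>R e + t *\<^sub>R f) = s\<^sup>2 * a + 2 * s * t * b + t\<^sup>2 * c"
    for s t
    unfolding a_b_c_def correlation_def sum_distrib_left sum.distrib[symmetric]
    by (intro sum.cong) (auto simp: inner_add_left power2_eq_square algebra_simps)
  have norm: "(norm (s *\<^sub>R e + t *\<^sub>R f))\<^sup>2 = s\<^sup>2 + t\<^sup>2" for s t
    using e f ef
    by (simp add: power2_norm_eq_inner inner_add_left inner_add_right inner_commute[of f e]
        norm_eq_1) (simp add: power2_eq_square)
  \<comment> \<open>Minimality is applied to \<open>e + t f\<close> scaled to unit length and then
    cleared of denominators.\<close>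
  have key: "0 \<le> 2 * t * b + t\<^sup>2 * (c - a)" for t
  proof -
    have "0 < sqrt (1 + t\<^sup>2)" "(sqrt (1 + t\<^sup>2))\<^sup>2 = 1 + t\<^sup>2"
      by (auto simp: add_pos_nonneg)
    then obtain k where k: "k > 0" "k\<^sup>2 = 1 + t\<^sup>2" by blast
    have "(1 / k)\<^sup>2 + (t / k)\<^sup>2 = (1 + t\<^sup>2) / k\<^sup>2"
      by (simp add: power_divide add_divide_distrib)
    also have "\<dots> = 1" unfolding k(2)[symmetric] using k(1) by simp
    finally have "(norm ((1 / k) *\<^sub>R e + (t / k) *\<^sub>R f))\<^sup>2 = 1"
      unfolding norm .
    then have "norm ((1 / k) *\<^sub>R e + (t / k) *\<^sub>R f) = 1"
      using norm_ge_zero[of "(1 / k) *\<^sub>R e + (t / k) *\<^sub>R f"] unfolding power2_eq_1_iff by linarith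
    from min[OF this] have "a \<le> (1 / k)\<^sup>2 * a + 2 * (1 / k) * (t / k) * b + (t / k)\<^sup>2 * c"
      by (simp only: expand a_b_c_def(1)[symmetric])
    also have "\<dots> = (a + 2 * t * b + t\<^sup>2 * c) / k\<^sup>2"
      using k(1) by (simp add: field_simps power2_eq_square)
    finally have "a * k\<^sup>2 \<le> a + 2 * t * b + t\<^sup>2 * c"
      using k(1) by (simp add: pos_le_divide_eq)
    then show ?thesis unfolding k(2) by (simp add: algebra_simps)
  qed
  have "b = 0"
  proof (rule ccontr)
    assume b: "b \<noteq> 0"
    \<comment> \<open>For small \<open>t\<close> the linear term dominates: with this
      \<open>k\<close>, the choice \<open>t = - b / k\<close> makes the expression in
      \<open>key\<close> at most \<open>- b^2 / k\<close>, which is negative.\<close>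
    define k where "k = \<bar>c - a\<bar> + 1"
    have k: "k > 0" "c - a < k" by (auto simp: k_def)
    have "0 \<le> 2 * (- b / k) * b + (- b / k)\<^sup>2 * (c - a)" by (rule key)
    also have "\<dots> \<le> 2 * (- b / k) * b + (- b / k)\<^sup>2 * k"
      using k by (intro add_left_mono mult_left_mono) auto
    also have "\<dots> = - (b\<^sup>2 / k)" using k by (simp add: field_simps power2_eq_square)
    finally show False using b k by (simp add: field_simps)
  qed
  then show ?thesis by (simp add: a_b_c_def)
qed

lemma correlation_minimizer_exists:
  fixes r :: "nat \<Rightarrow> 'a::euclidean_space"
  assumes "compact S" "S \<noteq> {}"
  obtains e where "e \<in> S" "\<And>x. x \<in> S \<Longrightarrow> correlation n r e e \<le> correlation n r x x"
proof -
  have "continuous_on S (\<lambda>x. correlation n r x x)"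
    unfolding correlation_def by (intro continuous_intros)
  from continuous_attains_inf[OF assms this] that show thesis by blast
qed

text \<open>Spectral theorem by successive minimisation: \<open>c\<close> minimises over the sphere,
  \<open>b\<close> over the unit circle orthogonal to \<open>c\<close>, and the cross product
  completes the frame.\<close>

lemma correlation_principal_frame:
  fixes r :: "nat \<Rightarrow> real ^ 3"
  obtains e :: "nat \<Rightarrow> real ^ 3" where
    "\<And>i j. i < 3 \<Longrightarrow> j < 3 \<Longrightarrow> inner (e i) (e j) = (if i = j then 1 else 0)"
    "\<And>i j. i < 3 \<Longrightarrow> j < 3 \<Longrightarrow> i \<noteq> j \<Longrightarrow> correlation n r (e i) (e j) = 0"
    "correlation n r (e 1) (e 1) \<le> correlation n r (e 0) (e 0)"
    "correlation n r (e 2) (e 2) \<le> correlation n r (e 1) (e 1)"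
    "\<And>x. norm x = 1 \<Longrightarrow> correlation n r (e 2) (e 2) \<le> correlation n r x x"
proof -
  have "sphere 0 1 \<noteq> ({} :: (real ^ 3) set)" by simp
  then obtain c where c: "norm c = 1"
    and minc: "\<And>x. norm x = 1 \<Longrightarrow> correlation n r c c \<le> correlation n r x x"
    using correlation_minimizer_exists[of "sphere 0 1 :: (real ^ 3) set" n r] by auto
  let ?S = "sphere 0 1 \<inter> {x. inner c x = 0}"
  obtain y where y: "y \<noteq> 0" "inner c y = 0"
    using orthogonal_to_vector_exists[of c] by (auto simp: Linear_Algebra.orthogonal_def)
  then have "(1 / norm y) *\<^sub>R y \<in> ?S" by simp
  then have "?S \<noteq> {}" by blast
  moreover have "compact ?S"
    by (intro compact_Int_closed closed_hyperplane) auto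
  ultimately obtain b where "b \<in> ?S"
    and minS: "\<And>x. x \<in> ?S \<Longrightarrow> correlation n r b b \<le> correlation n r x x"
    using correlation_minimizer_exists[of ?S n r] by blast
  then have b: "norm b = 1" "inner c b = 0"
    and minb: "\<And>x. norm x = 1 \<Longrightarrow> inner c x = 0 \<Longrightarrow> correlation n r b b \<le> correlation n r x x"
    by auto
  let ?a = "cross3 b c"
  have "(norm ?a)\<^sup>2 = 1"
    using norm_cross[of b c]
    by (simp add: b c inner_commute[of b c])
  then have a: "norm ?a = 1"
    using norm_ge_zero[of ?a] unfolding power2_eq_1_iff by linarith
  have ac: "inner c ?a = 0" and ab: "inner b ?a = 0"
    by (simp_all add: dot_cross_self)
  have cc: "correlation n r c b = 0" "correlation n r c ?a = 0"
    by (rule correlation_minimizer_orthogonal; use a b c ac minc in simp)+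
  \<comment> \<open>Minimality of \<open>b\<close> on the circle suffices, since every combination
    of \<open>b\<close> and \<open>?a\<close> is orthogonal to \<open>c\<close>.\<close>
  have "correlation n r b ?a = 0"
    by (rule correlation_minimizer_orthogonal;
        use a b c ac ab minb in \<open>simp add: inner_add_right\<close>)
  note zero = cc this
  \<comment> \<open>The vectors were found in increasing order of their values and are numbered in
    reverse, so the global minimiser becomes \<open>e 2\<close>.\<close>
  define e where "e i = (if i = 0 then ?a else if i = 1 then b else c)" for i :: nat
  have e: "e 0 = ?a" "e 1 = b" "e (Suc 0) = b" "e 2 = c" by (auto simp: e_def)
  have three: "i < 3 \<longleftrightarrow> i = 0 \<or> i = 1 \<or> i = 2" for i :: nat by auto
  show thesis
  proof (rule that[of e])
    show "inner (e i) (e j) = (if i = j then 1 else 0)" if "i < 3" "j < 3" for i j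
      using that a b c ac ab by (auto simp: three e norm_eq_1 inner_commute)
    show "correlation n r (e i) (e j) = 0" if "i < 3" "j < 3" "i \<noteq> j" for i j
      using that zero by (auto simp: three e correlation_commute)
  qed (use a b c ac minb minc in \<open>auto simp: e\<close>)
qed

text \<open>Parseval: the matrix with rows \<open>e 0\<close>, \<open>e 1\<close>,
  \<open>e 2\<close> is orthogonal and so preserves inner products.\<close>

lemma inner_orthonormal_frame:
  fixes e :: "nat \<Rightarrow> real ^ 3"
  assumes "\<And>i j. i < 3 \<Longrightarrow> j < 3 \<Longrightarrow> inner (e i) (e j) = (if i = j then 1 else 0)"
  shows "inner x y = (\<Sum>i<3. inner (e i) x * inner (e i) y)"
proof -
  define A :: "real ^ 3 ^ 3" where "A = vector [e 0, e 1, e 2]"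
  have row_eq: "Finite_Cartesian_Product.row i M = M $ i" for i and M :: "real ^ 3 ^ 3"
    by (simp add: Finite_Cartesian_Product.row_def)
  have "orthogonal_matrix A"
    unfolding orthogonal_matrix_orthonormal_rows A_def
    using assms by (auto simp: forall_3 row_eq Linear_Algebra.orthogonal_def norm_eq_1)
  then have "orthogonal_transformation ((*v) A)"
    by (simp add: orthogonal_transformation_matrix)
  then have "inner x y = inner (A *v x) (A *v y)"
    by (simp add: orthogonal_transformation_def)
  also have "\<dots> = (\<Sum>i<3. inner (e i) x * inner (e i) y)"
    unfolding inner_vec_def[of "A *v x"] matrix_vector_mul_component sum_3
    by (simp add: A_def numeral_3_eq_3 numeral_2_eq_2)
  finally show ?thesis .
qed

text \<open>The first three rows of \<open>W\<close> hold the coordinates of the \<open>r k\<close>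
  in the frame \<open>e\<close>. By Parseval \<open>W\<close> factors the Gram matrix, while
  \<open>W * transpose_mat W\<close> holds the correlations of the frame vectors and is therefore
  diagonal. The bound \<open>3 <= n\<close> leaves room for all three rows.\<close>

lemma gram_matrix_eigenvalues:
  fixes e r :: "nat \<Rightarrow> real ^ 3"
  assumes n: "3 \<le> n"
    and orth: "\<And>i j. i < 3 \<Longrightarrow> j < 3 \<Longrightarrow> inner (e i) (e j) = (if i = j then 1 else 0)"
    and diag: "\<And>i j. i < 3 \<Longrightarrow> j < 3 \<Longrightarrow> i \<noteq> j \<Longrightarrow> correlation n r (e i) (e j) = 0"
    and le: "correlation n r (e 1) (e 1) \<le> correlation n r (e 0) (e 0)"
      "correlation n r (e 2) (e 2) \<le> correlation n r (e 1) (e 1)"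
  shows "eigenvalues_desc (gram_matrix n r) =
    map (\<lambda>i. if i < 3 then correlation n r (e i) (e i) else 0) [0..<n]"
proof -
  \<comment> \<open>Zero-padded to a square matrix, so that \<open>W\<^sup>T W\<close> and \<open>W W\<^sup>T\<close> have the same characteristic
    polynomial.\<close>
  define W where "W = Matrix.mat n n (\<lambda>(i, k). if i < 3 then inner (e i) (r k) else 0)"
  have W: "W \<in> carrier_mat n n" by (simp add: W_def)
  have "gram_matrix n r = transpose_mat W * W"
  proof (intro eq_matI)
    fix k l assume kl: "k < dim_row (transpose_mat W * W)" "l < dim_col (transpose_mat W * W)"
    have "(transpose_mat W * W) $$ (k, l) =
        (\<Sum>i\<in>{0..<n}. if i < 3 then inner (e i) (r k) * inner (e i) (r l) else 0)"
      using kl by (auto simp: W_def scalar_prod_def intro!: sum.cong)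
    also have "\<dots> = (\<Sum>i<3. inner (e i) (r k) * inner (e i) (r l))"
      using n by (intro sum.mono_neutral_cong_right) auto
    also have "\<dots> = inner (r k) (r l)"
      by (rule inner_orthonormal_frame[OF orth, symmetric])
    finally show "gram_matrix n r $$ (k, l) = (transpose_mat W * W) $$ (k, l)"
      using kl by (simp add: gram_matrix_def W_def)
  qed (simp_all add: gram_matrix_def W_def)
  moreover have WWt: "(W * transpose_mat W) $$ (i, j) =
      (if i < 3 \<and> j < 3 then correlation n r (e i) (e j) else 0)" if "i < n" "j < n" for i j
    using that
    by (cases "i < 3"; cases "j < 3")
      (simp_all add: W_def scalar_prod_def correlation_def atLeast0LessThan)
  have dm: "diag_mat (W * transpose_mat W) =
      map (\<lambda>i. if i < 3 then correlation n r (e i) (e i) else 0) [0..<n]"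
    using W by (auto simp: diag_mat_def WWt simp del: index_mult_mat(1))
  \<comment> \<open>Nonnegativity lets the padding zeros follow the three frame values in decreasing
    order.\<close>
  have "0 \<le> correlation n r (e i) (e i)" for i
    by (auto simp: correlation_def intro: sum_nonneg)
  moreover have three: "i < 3 \<longleftrightarrow> i = 0 \<or> i = 1 \<or> i = 2" for i :: nat by auto
  ultimately have sorted: "sorted_wrt (\<ge>) (diag_mat (W * transpose_mat W))"
    unfolding dm using le by (auto simp: sorted_wrt_iff_nth_less three numeral_2_eq_2)
  show ?thesis
    unfolding \<open>gram_matrix n r = _\<close> dm[symmetric]
    by (rule eigenvalues_desc_transpose_mult[OF W _ sorted])
      (use diag in \<open>auto simp: WWt simp del: index_mult_mat(1)\<close>)
qed

section \<open>Density matrices, Bloch vectors and the robustness of a single state\<close>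

lemma vec_eq_2: "A = B \<longleftrightarrow> A $ 1 = B $ 1 \<and> A $ 2 = B $ 2" for A B :: "'a ^ 2"
  by (simp only: Finite_Cartesian_Product.vec_eq_iff[of A B] forall_2)

lemma hermitian_iff:
  "hermitian A \<longleftrightarrow> Im (A $ 1 $ 1) = 0 \<and> Im (A $ 2 $ 2) = 0 \<and> A $ 2 $ 1 = cnj (A $ 1 $ 2)"
  by (auto simp: hermitian_def dagger_def vec_eq_2 complex_eq_iff)

lemma hermitian_conjugation:
  assumes "hermitian A"
  shows "hermitian (U ** A ** dagger U)"
  using assms
  by (simp add: hermitian_iff matrix_matrix_mult_def dagger_def sum_2 complex_eq_iff algebra_simps)

lemma real_entries_iff_hermitian:
  assumes "hermitian A"
  shows "real_entries A \<longleftrightarrow> Im (A $ 1 $ 2) = 0"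
  using assms by (auto simp: real_entries_def hermitian_iff forall_2 complex_is_Real_iff)

text \<open>At trace 1 the left-hand side is 1 minus four times the determinant, so the claim
  amounts to a nonnegative determinant.\<close>

lemma density_matrix_bloch_bound:
  assumes "density_matrix A"
  shows "(2 * Re (A $ 1 $ 2))\<^sup>2 + (2 * Im (A $ 1 $ 2))\<^sup>2 + (Re (A $ 1 $ 1) - Re (A $ 2 $ 2))\<^sup>2 \<le> 1"
proof -
  have h: "Im (A $ 1 $ 1) = 0" "Im (A $ 2 $ 2) = 0" "A $ 2 $ 1 = cnj (A $ 1 $ 2)"
    using assms by (auto simp: density_matrix_def psd_def hermitian_iff)
  have tr: "Re (A $ 1 $ 1) + Re (A $ 2 $ 2) = 1"
    using assms by (simp add: density_matrix_def Determinants.trace_def sum_2 complex_eq_iff)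
  have pos: "0 \<le> Re (\<Sum>i\<in>UNIV. cnj (v $ i) * (A *v v) $ i)" for v :: "complex ^ 2"
    using assms by (simp add: density_matrix_def psd_def)
  define p q x y where "p = Re (A $ 1 $ 1)" "q = Re (A $ 2 $ 2)"
    "x = Re (A $ 1 $ 2)" "y = Im (A $ 1 $ 2)"
  \<comment> \<open>The test vectors are, up to sign and order, columns of the adjugate; there the
    form takes the values \<open>p\<close> and \<open>q\<close> times the determinant. Adding them
    and using \<open>p + q = 1\<close> avoids dividing by \<open>p\<close> or \<open>q\<close>,
    either of which may be 0.\<close>
  have "0 \<le> p * (p * q - x\<^sup>2 - y\<^sup>2)"
    using pos[of "vector [A $ 1 $ 2, - (A $ 1 $ 1)]"] h
    by (simp add: sum_2 matrix_vector_mult_def p_q_x_y_def power2_eq_square algebra_simps)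
  moreover have "0 \<le> q * (p * q - x\<^sup>2 - y\<^sup>2)"
    using pos[of "vector [- (A $ 2 $ 2), A $ 2 $ 1]"] h
    by (simp add: sum_2 matrix_vector_mult_def p_q_x_y_def power2_eq_square algebra_simps)
  ultimately have "0 \<le> (p + q) * (p * q - x\<^sup>2 - y\<^sup>2)"
    by (simp only: distrib_right)
  moreover have "p + q = 1" using tr by (simp add: p_q_x_y_def)
  moreover have "(p - q)\<^sup>2 = (p + q)\<^sup>2 - 4 * (p * q)"
    by (simp add: power2_eq_square algebra_simps)
  ultimately have "(2 * x)\<^sup>2 + (2 * y)\<^sup>2 + (p - q)\<^sup>2 \<le> 1"
    by (simp add: power_mult_distrib)
  then show ?thesis by (simp add: p_q_x_y_def)
qed

text \<open>For the definite description, existence rests on the norm bound and uniqueness on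
  comparing entries. The minus sign comes from the upper right entry of
  \<open>sigma_y\<close>.\<close>

lemma density_matrix_bloch_vector:
  assumes "density_matrix A"
  shows "bloch_vector A = vector [2 * Re (A $ 1 $ 2), - 2 * Im (A $ 1 $ 2), Re (A $ 1 $ 1) - Re (A $ 2 $ 2)]"
    (is "_ = ?r")
  unfolding bloch_vector_def
proof (rule the_equality)
  have h: "Im (A $ 1 $ 1) = 0" "Im (A $ 2 $ 2) = 0" "A $ 2 $ 1 = cnj (A $ 1 $ 2)"
    using assms by (auto simp: density_matrix_def psd_def hermitian_iff)
  have tr: "Re (A $ 1 $ 1) + Re (A $ 2 $ 2) = 1"
    using assms by (simp add: density_matrix_def Determinants.trace_def sum_2 complex_eq_iff)
  have "norm ?r \<le> 1"
    using density_matrix_bloch_bound[OF assms]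
    by (simp add: norm_le_square[of _ 1, simplified] inner_vec_def sum_3 power2_eq_square)
  moreover have "A = (1 / 2) *\<^sub>R (Finite_Cartesian_Product.mat 1 +
           (?r $ 1 *\<^sub>R sigma_x + ?r $ 2 *\<^sub>R sigma_y + ?r $ 3 *\<^sub>R sigma_z))"
    using h tr by (auto simp: vec_eq_2 sigma_x_def sigma_y_def sigma_z_def
        Finite_Cartesian_Product.mat_def complex_eq_iff)
  ultimately show "norm ?r \<le> 1 \<and> A = (1 / 2) *\<^sub>R (Finite_Cartesian_Product.mat 1 +
           (?r $ 1 *\<^sub>R sigma_x + ?r $ 2 *\<^sub>R sigma_y + ?r $ 3 *\<^sub>R sigma_z))" ..
next
  fix r :: "real ^ 3"
  assume "norm r \<le> 1 \<and> A = (1 / 2) *\<^sub>R (Finite_Cartesian_Product.mat 1 +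
           (r $ 1 *\<^sub>R sigma_x + r $ 2 *\<^sub>R sigma_y + r $ 3 *\<^sub>R sigma_z))"
  then show "r = ?r"
    by (auto simp: Finite_Cartesian_Product.vec_eq_iff forall_3 sigma_x_def sigma_y_def sigma_z_def
        Finite_Cartesian_Product.mat_def add_divide_distrib diff_divide_distrib)
qed

lemma norm_bloch_vector_le:
  assumes "density_matrix A"
  shows "norm (bloch_vector A) \<le> 1"
  using density_matrix_bloch_bound[OF assms]
  by (simp add: density_matrix_bloch_vector[OF assms] norm_le_square[of _ 1, simplified]
      inner_vec_def sum_3 power2_eq_square)

text \<open>Mixing must cancel the imaginary part of the (1,2) entry. A state contributes at most
  1/2 in modulus there, and an eigenstate of \<open>sigma_y\<close> of the right sign contributes
  exactly that.\<close>

lemma Im_R_hermitian: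
  assumes "hermitian A"
  shows "Im_R A = 2 * \<bar>Im (A $ 1 $ 2)\<bar>"
  unfolding Im_R_def
proof (rule Least_equality)
  define s where "s = 2 * \<bar>Im (A $ 1 $ 2)\<bar>"
  \<comment> \<open>The sign \<open>c\<close> is opposite to that of the imaginary part to be
    cancelled, and \<open>T\<close> is the projection \<open>(1 - c sigma_y) / 2\<close>.\<close>
  define c where "c = (if Im (A $ 1 $ 2) < 0 then 1 else - 1 :: real)"
  define T :: "complex ^ 2 ^ 2" where
    "T = vector [vector [1 / 2, c / 2 * \<i>], vector [- (c / 2 * \<i>), 1 / 2]]"
  have cc: "c * c = 1" by (simp add: c_def)
  have hT: "hermitian T" by (simp add: hermitian_iff T_def)
  have "0 \<le> Re (\<Sum>i\<in>UNIV. cnj (v $ i) * (T *v v) $ i)" for v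
  proof -
    \<comment> \<open>The form equals half the squared modulus of \<open>v $ 1 + c i v $ 2\<close>,
      because \<open>c * c = 1\<close>.\<close>
    have eq: "Re (\<Sum>i\<in>UNIV. cnj (v $ i) * (T *v v) $ i) =
        ((Re (v $ 1) - c * Im (v $ 2))\<^sup>2 + (Im (v $ 1) + c * Re (v $ 2))\<^sup>2) / 2"
      using cc by (auto simp: sum_2 matrix_vector_mult_def T_def power2_eq_square square_eq_1_iff
          field_simps)
    show ?thesis unfolding eq by simp
  qed
  then have T: "density_matrix T"
    using hT by (simp add: density_matrix_def psd_def Determinants.trace_def sum_2 T_def)
  have "hermitian ((1 / (s + 1)) *\<^sub>R (A + s *\<^sub>R T))"
    using assms hT by (simp add: hermitian_iff complex_eq_iff)
  moreover have "Im (((1 / (s + 1)) *\<^sub>R (A + s *\<^sub>R T)) $ 1 $ 2) = 0"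
    by (simp add: T_def s_def c_def)
  ultimately have "real_entries ((1 / (s + 1)) *\<^sub>R (A + s *\<^sub>R T))"
    by (simp add: real_entries_iff_hermitian)
  with T show "0 \<le> 2 * \<bar>Im (A $ 1 $ 2)\<bar> \<and> (\<exists>T. density_matrix T \<and>
      real_entries ((1 / (2 * \<bar>Im (A $ 1 $ 2)\<bar> + 1)) *\<^sub>R (A + (2 * \<bar>Im (A $ 1 $ 2)\<bar>) *\<^sub>R T)))"
    unfolding s_def by auto
next
  fix s :: real
  assume "0 \<le> s \<and> (\<exists>T. density_matrix T \<and> real_entries ((1 / (s + 1)) *\<^sub>R (A + s *\<^sub>R T)))"
  then obtain T where s: "0 \<le> s" and T: "density_matrix T"
    and re: "real_entries ((1 / (s + 1)) *\<^sub>R (A + s *\<^sub>R T))" by blast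
  have "Im (((1 / (s + 1)) *\<^sub>R (A + s *\<^sub>R T)) $ 1 $ 2) = 0"
    using re by (simp add: real_entries_def complex_is_Real_iff del: vector_scaleR_component)
  then have A: "Im (A $ 1 $ 2) = - s * Im (T $ 1 $ 2)"
    using s by (simp add: add_nonneg_pos)
  have "(2 * Im (T $ 1 $ 2))\<^sup>2 \<le> 1"
    using density_matrix_bloch_bound[OF T] by (smt (verit) zero_le_power2)
  then have "2 * \<bar>Im (T $ 1 $ 2)\<bar> \<le> 1" unfolding abs_square_le_1 by (simp add: abs_mult)
  from mult_left_mono[OF this s] show "2 * \<bar>Im (A $ 1 $ 2)\<bar> \<le> s"
    using s by (simp add: A abs_mult)
qed

section \<open>Unitary conjugation as rotation of Bloch vectors\<close>

text \<open>The unit vector \<open>m\<close> with \<open>U\<^sup>\<dagger> \<sigma>\<^sub>y U = m \<bullet> \<sigma>\<close>.\<close>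

definition y_axis_pullback :: "complex ^ 2 ^ 2 \<Rightarrow> real ^ 3" where
  "y_axis_pullback U = (let P = U $ 1 $ 1 * cnj (U $ 2 $ 2); Q = U $ 1 $ 2 * cnj (U $ 2 $ 1)
    in vector [- Im (P + Q), Re (P - Q), - 2 * Im (U $ 1 $ 1 * cnj (U $ 2 $ 1))])"

lemma unitary_rows:
  assumes "unitary U"
  shows "U $ 1 $ 2 * cnj (U $ 2 $ 2) = - (U $ 1 $ 1 * cnj (U $ 2 $ 1))"
    "(cmod (U $ 1 $ 1))\<^sup>2 + (cmod (U $ 1 $ 2))\<^sup>2 = 1"
    "(cmod (U $ 2 $ 1))\<^sup>2 + (cmod (U $ 2 $ 2))\<^sup>2 = 1"
proof -
  have eq: "(U ** dagger U) $ i $ j = Finite_Cartesian_Product.mat 1 $ i $ j" for i j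
    using assms by (simp add: unitary_def)
  have "U $ 1 $ 1 * cnj (U $ 2 $ 1) + U $ 1 $ 2 * cnj (U $ 2 $ 2) = 0"
    using eq[of 1 2] by (simp add: dagger_def matrix_matrix_mult_def sum_2
        Finite_Cartesian_Product.mat_def)
  then show "U $ 1 $ 2 * cnj (U $ 2 $ 2) = - (U $ 1 $ 1 * cnj (U $ 2 $ 1))"
    by (simp add: eq_neg_iff_add_eq_0 add.commute)
  show "(cmod (U $ 1 $ 1))\<^sup>2 + (cmod (U $ 1 $ 2))\<^sup>2 = 1"
    using arg_cong[OF eq[of 1 1], of Re] unfolding cmod_power2
    by (simp add: dagger_def matrix_matrix_mult_def sum_2
        Finite_Cartesian_Product.mat_def power2_eq_square)
  show "(cmod (U $ 2 $ 1))\<^sup>2 + (cmod (U $ 2 $ 2))\<^sup>2 = 1"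
    using arg_cong[OF eq[of 2 2], of Re] unfolding cmod_power2
    by (simp add: dagger_def matrix_matrix_mult_def sum_2
        Finite_Cartesian_Product.mat_def power2_eq_square)
qed

text \<open>Orthogonality of the rows turns the squared length into four products of squared moduli,
  which factor into the product of the two squared row lengths.\<close>

lemma norm_y_axis_pullback:
  assumes "unitary U"
  shows "norm (y_axis_pullback U) = 1"
proof -
  define a b c d where "a = U $ 1 $ 1" "b = U $ 1 $ 2" "c = U $ 2 $ 1" "d = U $ 2 $ 2"
  note abcd = this
  note rows = unitary_rows[OF assms, folded abcd]
  define P Q X where "P = a * cnj d" "Q = b * cnj c" "X = a * cnj c"
  note PQX = this
  have "P * Q = X * (b * cnj d)" by (simp add: PQX)
  then have PQ: "P * Q = - (X * X)" by (simp add: rows(1) PQX)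
  have y: "y_axis_pullback U = vector [- Im (P + Q), Re (P - Q), - 2 * Im X]"
    by (simp only: y_axis_pullback_def Let_def PQX abcd)
  have "inner (y_axis_pullback U) (y_axis_pullback U) =
      (Im (P + Q))\<^sup>2 + (Re (P - Q))\<^sup>2 + (2 * Im X)\<^sup>2"
    by (simp add: y inner_vec_def sum_3 power2_eq_square algebra_simps)
  also have "\<dots> = (cmod P)\<^sup>2 + (cmod Q)\<^sup>2 - 2 * Re (P * Q) + 4 * (Im X)\<^sup>2"
    unfolding cmod_power2 by (simp add: power2_eq_square algebra_simps)
  also have "\<dots> = (cmod P)\<^sup>2 + (cmod Q)\<^sup>2 + 2 * (cmod X)\<^sup>2"
    unfolding PQ cmod_power2 by (simp add: power2_eq_square algebra_simps)
  also have "\<dots> = (cmod P)\<^sup>2 + (cmod Q)\<^sup>2 + (cmod X)\<^sup>2 + (cmod (b * cnj d))\<^sup>2"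
    unfolding rows(1) by (simp add: PQX)
  also have "\<dots> = ((cmod a)\<^sup>2 + (cmod b)\<^sup>2) * ((cmod c)\<^sup>2 + (cmod d)\<^sup>2)"
    by (simp add: PQX norm_mult power_mult_distrib algebra_simps)
  finally show ?thesis using rows by (simp add: norm_eq_1)
qed

text \<open>By cyclicity of the trace, the y-component of the Bloch vector of
  \<open>U ** A ** dagger U\<close> is the pairing of the Bloch vector of \<open>A\<close> with the
  pulled-back axis. The proof checks this on the (1,2) entry; its sign disappears in the
  modulus.\<close>

lemma Im_R_unitary_conjugation:
  assumes U: "unitary U" and A: "density_matrix A"
  shows "Im_R (U ** A ** dagger U) = \<bar>inner (y_axis_pullback U) (bloch_vector A)\<bar>"
proof -
  have hA: "hermitian A" using A by (simp add: density_matrix_def psd_def)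
  then have h: "Im (A $ 1 $ 1) = 0" "Im (A $ 2 $ 2) = 0" "A $ 2 $ 1 = cnj (A $ 1 $ 2)"
    by (auto simp: hermitian_iff)
  define P Q X where "P = U $ 1 $ 1 * cnj (U $ 2 $ 2)" "Q = U $ 1 $ 2 * cnj (U $ 2 $ 1)"
    "X = U $ 1 $ 1 * cnj (U $ 2 $ 1)"
  note PQX = this
  have "(U ** A ** dagger U) $ 1 $ 2 =
      P * A $ 1 $ 2 + Q * A $ 2 $ 1 + X * A $ 1 $ 1 + (U $ 1 $ 2 * cnj (U $ 2 $ 2)) * A $ 2 $ 2"
    by (simp add: matrix_matrix_mult_def sum_2 dagger_def PQX algebra_simps)
  also have "\<dots> = P * A $ 1 $ 2 + Q * cnj (A $ 1 $ 2) + X * (A $ 1 $ 1 - A $ 2 $ 2)"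
    unfolding unitary_rows(1)[OF U] by (simp add: h PQX algebra_simps)
  finally have "Im ((U ** A ** dagger U) $ 1 $ 2) =
      Im (P * A $ 1 $ 2 + Q * cnj (A $ 1 $ 2) + X * (A $ 1 $ 1 - A $ 2 $ 2))"
    by (rule arg_cong)
  then have "2 * Im ((U ** A ** dagger U) $ 1 $ 2) = - inner (y_axis_pullback U) (bloch_vector A)"
    by (simp add: density_matrix_bloch_vector[OF A] inner_vec_def sum_3 y_axis_pullback_def Let_def
        PQX[symmetric] h algebra_simps)
  then show ?thesis
    by (simp add: Im_R_hermitian[OF hermitian_conjugation[OF hA]])
qed

lemma y_axis_pullback_surj:
  fixes m :: "real ^ 3"
  assumes m: "norm m = 1"
  obtains U where "unitary U" "y_axis_pullback U = m"
proof -
  have mm: "(m $ 1)\<^sup>2 + (m $ 2)\<^sup>2 + (m $ 3)\<^sup>2 = 1"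
    using m by (simp add: norm_eq_1 inner_vec_def sum_3 power2_eq_square)
  \<comment> \<open>These are the coefficients of \<open>U = a + i (b sigma_z + d sigma_x)\<close>,
    a rotation about an axis orthogonal to the y-axis; \<open>a\<close> is the cosine of half the
    angle between \<open>m\<close> and the y-axis.\<close>
  obtain a b d :: real where abd: "a\<^sup>2 + b\<^sup>2 + d\<^sup>2 = 1" "m $ 1 = - 2 * a * b"
      "m $ 2 = a\<^sup>2 - b\<^sup>2 - d\<^sup>2" "m $ 3 = 2 * a * d"
  proof (cases "m $ 2 = - 1")
    case True
    then have "m $ 1 = 0" "m $ 3 = 0" using mm by (auto simp: add_nonneg_eq_0_iff)
    \<comment> \<open>At the antipode \<open>a\<close> is 0 and the quotients below are undefined; a
      half turn about the z-axis serves instead.\<close>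
    with True that[of 0 1 0] show thesis by simp
  next
    case False
    define a where "a = sqrt ((1 + m $ 2) / 2)"
    have "\<bar>m $ 2\<bar> \<le> 1" using component_le_norm_cart[of m 2] m by simp
    with False have a: "a > 0" "a\<^sup>2 = (1 + m $ 2) / 2" by (auto simp: a_def)
    have "(m $ 1)\<^sup>2 + (m $ 3)\<^sup>2 = 4 * a\<^sup>2 * (1 - a\<^sup>2)"
      using mm unfolding a(2) by (simp add: power2_eq_square field_simps)
    moreover define b d where "b = - m $ 1 / (2 * a)" "d = m $ 3 / (2 * a)"
    then have bd: "m $ 1 = - 2 * a * b" "m $ 3 = 2 * a * d" using a(1) by simp_all
    ultimately have "4 * a\<^sup>2 * (b\<^sup>2 + d\<^sup>2) = 4 * a\<^sup>2 * (1 - a\<^sup>2)"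
      by (simp add: power_mult_distrib distrib_left)
    then have "b\<^sup>2 + d\<^sup>2 = 1 - a\<^sup>2" using a(1) by simp
    moreover have "m $ 2 = 2 * a\<^sup>2 - 1" unfolding a(2) by (simp add: field_simps)
    ultimately show thesis using that[of a b d] bd by simp
  qed
  \<comment> \<open>For a special unitary matrix with first row \<open>(u, v)\<close> the vector is
    \<open>(Im (v\<^sup>2 - u\<^sup>2), Re (u\<^sup>2 + v\<^sup>2), 2 Im (u v))\<close>.\<close>
  define u v where "u = Complex a b" "v = Complex 0 d"
  define U :: "complex ^ 2 ^ 2" where "U = vector [vector [u, v], vector [- cnj v, cnj u]]"
  have "unitary U"
    using abd(1)
    by (simp add: unitary_def U_def vec_eq_2 dagger_def matrix_matrix_mult_def sum_2
        Finite_Cartesian_Product.mat_def u_v_def complex_eq_iff power2_eq_square algebra_simps)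
  moreover have "y_axis_pullback U = m"
    by (simp add: Finite_Cartesian_Product.vec_eq_iff[of _ m] forall_3 y_axis_pullback_def Let_def
        U_def u_v_def abd power2_eq_square)
  ultimately show thesis by (rule that)
qed

section \<open>Minimisation over the unit sphere and the resulting bounds\<close>

text \<open>Unitaries and unit vectors yield the same set of values, and a continuous function on
  the compact sphere attains its minimum, so the \<open>LEAST\<close> in \<open>Im_R1\<close> is a
  true minimum. The lower bound uses the minimiser \<open>m\<close>, the upper bound the comparison
  with other unit vectors.\<close>

lemma Im_R1_eq_min:
  assumes "\<And>j. j < n \<Longrightarrow> density_matrix (\<rho> j)"
  obtains m where "norm m = 1"
    "Im_R1 n \<rho> = (\<Sum>j<n. \<bar>inner m (bloch_vector (\<rho> j))\<bar>) / real n"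
    "\<And>x. norm x = 1 \<Longrightarrow> Im_R1 n \<rho> \<le> (\<Sum>j<n. \<bar>inner x (bloch_vector (\<rho> j))\<bar>) / real n"
proof -
  let ?f = "\<lambda>x. (\<Sum>j<n. \<bar>inner x (bloch_vector (\<rho> j))\<bar>) / real n"
  let ?P = "\<lambda>v. \<exists>U. unitary U \<and> v = (1 / real n) * (\<Sum>j<n. Im_R (U ** \<rho> j ** dagger U))"
  have f: "(1 / real n) * (\<Sum>j<n. Im_R (U ** \<rho> j ** dagger U)) = ?f (y_axis_pullback U)"
    if "unitary U" for U
    using assms by (simp add: Im_R_unitary_conjugation[OF that])
  have P: "?P v \<longleftrightarrow> (\<exists>x. norm x = 1 \<and> v = ?f x)" for v
  proof
    assume "?P v"
    then show "\<exists>x. norm x = 1 \<and> v = ?f x"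
      using f norm_y_axis_pullback by blast
  next
    assume "\<exists>x. norm x = 1 \<and> v = ?f x"
    then obtain x where x: "norm x = 1" "v = ?f x" by blast
    obtain U where "unitary U" "y_axis_pullback U = x"
      using y_axis_pullback_surj[OF x(1)] .
    with x(2) f show "?P v" by metis
  qed
  have "continuous_on (sphere 0 1) ?f"
    unfolding divide_inverse by (intro continuous_intros)
  moreover have "compact (sphere 0 1 :: (real ^ 3) set)" "sphere 0 1 \<noteq> ({} :: (real ^ 3) set)"
    by auto
  ultimately obtain m where m: "norm m = 1" "\<And>x. norm x = 1 \<Longrightarrow> ?f m \<le> ?f x"
    using continuous_attains_inf[of "sphere 0 1" ?f] by auto
  have "Im_R1 n \<rho> = ?f m"
    unfolding Im_R1_def P by (rule Least_equality) (use m in auto)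
  with m that show thesis by auto
qed

theorem mainTheorem4:
  fixes n :: nat and \<rho> :: "nat \<Rightarrow> complex ^ 2 ^ 2" and ev :: "real list"
  assumes "n \<ge> 3"
    and "\<And>j. j < n \<Longrightarrow> density_matrix (\<rho> j)"
    and "ev = eigenvalues_desc (gram_matrix n (\<lambda>j. bloch_vector (\<rho> j)))"
  shows "length ev = n \<and> (\<forall>i. 3 \<le> i \<and> i < n \<longrightarrow> ev ! i = 0) \<and>
    ev ! 2 / real n \<le> Im_R1 n \<rho> \<and>
    Im_R1 n \<rho> \<le> sqrt (ev ! 2 / real n) \<and>
    sqrt (ev ! 2 / real n) \<le> 1 / sqrt 3"
proof -
  define r where "r j = bloch_vector (\<rho> j)" for j
  have r1: "norm (r j) \<le> 1" if "j < n" for j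
    unfolding r_def using assms(2)[OF that] by (rule norm_bloch_vector_le)
  obtain e :: "nat \<Rightarrow> real ^ 3"
    where orth: "\<And>i j. i < 3 \<Longrightarrow> j < 3 \<Longrightarrow> inner (e i) (e j) = (if i = j then 1 else 0)"
    and diag: "\<And>i j. i < 3 \<Longrightarrow> j < 3 \<Longrightarrow> i \<noteq> j \<Longrightarrow> correlation n r (e i) (e j) = 0"
    and le: "correlation n r (e 1) (e 1) \<le> correlation n r (e 0) (e 0)"
      "correlation n r (e 2) (e 2) \<le> correlation n r (e 1) (e 1)"
    and min: "\<And>x. norm x = 1 \<Longrightarrow> correlation n r (e 2) (e 2) \<le> correlation n r x x"
    by (rule correlation_principal_frame[of n r]) blast
  define q where "q = correlation n r (e 2) (e 2)"
  have ev: "ev = map (\<lambda>i. if i < 3 then correlation n r (e i) (e i) else 0) [0..<n]"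
    unfolding assms(3) r_def[symmetric]
    by (rule gram_matrix_eigenvalues[OF assms(1) orth diag le])
  then have q: "ev ! 2 = q" using assms(1) by (simp add: q_def numeral_2_eq_2)
  obtain m where m: "norm m = 1" and Im: "Im_R1 n \<rho> = (\<Sum>j<n. \<bar>inner m (r j)\<bar>) / real n"
    and Im_le: "\<And>x. norm x = 1 \<Longrightarrow> Im_R1 n \<rho> \<le> (\<Sum>j<n. \<bar>inner x (r j)\<bar>) / real n"
    by (rule Im_R1_eq_min[of n \<rho>, OF assms(2), folded r_def]) (assumption, rule that)
  have "q \<le> correlation n r m m" unfolding q_def by (rule min[OF m])
  also have "\<dots> \<le> (\<Sum>j<n. \<bar>inner m (r j)\<bar>)"
    unfolding correlation_def
  proof (rule sum_mono)
    fix j assume "j \<in> {..<n}"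
    then have "\<bar>inner m (r j)\<bar> \<le> 1"
      using Cauchy_Schwarz_ineq2[of m "r j"] m r1[of j] by simp
    then have "\<bar>inner m (r j)\<bar> * \<bar>inner m (r j)\<bar> \<le> \<bar>inner m (r j)\<bar> * 1"
      by (intro mult_left_mono) auto
    then show "inner m (r j) * inner m (r j) \<le> \<bar>inner m (r j)\<bar>" by simp
  qed
  finally have lower: "q / real n \<le> Im_R1 n \<rho>"
    unfolding Im by (rule divide_right_mono) simp
  \<comment> \<open>Cauchy--Schwarz against the constant vector of length \<open>n\<close>, at the
    trial direction \<open>e 2\<close>, which need not minimise the mean of the moduli.\<close>
  have "(\<Sum>j<n. \<bar>inner (e 2) (r j)\<bar>)\<^sup>2 \<le> q * real n"
    using sum_squared_le_sum_of_squares[of "\<lambda>j. \<bar>inner (e 2) (r j)\<bar>" "{..<n}"]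
    by (simp add: q_def correlation_def power2_eq_square)
  then have "((\<Sum>j<n. \<bar>inner (e 2) (r j)\<bar>) / real n)\<^sup>2 \<le> q / real n"
    using assms(1) by (simp add: power_divide divide_simps power2_eq_square)
  then have "(\<Sum>j<n. \<bar>inner (e 2) (r j)\<bar>) / real n \<le> sqrt (q / real n)"
    by (rule real_le_rsqrt)
  moreover have "norm (e 2) = 1" using orth[of 2 2] by (simp add: norm_eq_1)
  ultimately have upper: "Im_R1 n \<rho> \<le> sqrt (q / real n)"
    using Im_le[of "e 2"] by linarith
  have frame: "inner x y = (\<Sum>i<3. inner (e i) x * inner (e i) y)" for x y
    using orth by (rule inner_orthonormal_frame)
  \<comment> \<open>Three copies of the smallest value are at most the trace, which Parseval turns
    into the sum of the squared Bloch lengths.\<close>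
  have "3 * q \<le> (\<Sum>i<3. correlation n r (e i) (e i))"
    using le by (simp add: q_def numeral_3_eq_3 numeral_2_eq_2)
  also have "\<dots> = (\<Sum>j<n. inner (r j) (r j))"
    unfolding correlation_def frame[of "r _"] by (rule sum.swap)
  also have "\<dots> \<le> (\<Sum>j<n. 1)"
    using r1 by (intro sum_mono) (simp add: norm_le_square[of _ 1, simplified])
  finally have "q / real n \<le> 1 / 3" using assms(1) by (simp add: field_simps)
  then have "sqrt (q / real n) \<le> 1 / sqrt 3"
    using real_sqrt_le_mono[of "q / real n" "1 / 3"] by (simp add: real_sqrt_divide)
  then show ?thesis
    using lower upper unfolding q by (auto simp: ev)
qed

end
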